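(* Let $(M,D)$ be a compact metric space and let $(\mathcal{F},\mu)$, $\mathcal{F}=\{f_i\}_{i\in\mathcal{I}}$, be a random dynamical system of continuous maps on $M$ such that $\mathcal{F}$ is proximal on $(M,D)$ and $(\mathcal{F},\mu)$ has the local contraction property on $(M,D)$ with local contraction rate $q\in(0,1)$. Then for any $\alpha\in(0,1]$ there exists $C>0$ such that for all $n\in\mathbb{N}$ $$\sup_{x,y\in M}\ \sum_{k=0}^{n}\int D^\alpha\big(X_k^x(\mathbf{i}),X_k^y(\mathbf{i})\big)\,d\mu^{\mathbb{N}}(\mathbf{i})\ \le\ C\sum_{k=0}^{n}q^{k\alpha}.$$
   Context: Random dynamical system: $C^0(M)$ is the space of continuous maps $f\colon M\to M$ with the supremum distance $D_\infty(f,g)=\sup_{x\in M}D(f(x),g(x))$. $\mathcal{F}=\{f_i\}_{i\in\mathcal{I}}\subset C^0(M)$ is indexed by a set $\mathcal{I}$ (one may take $\mathcal{I}=\mathcal{F}$); $\mathcal{I}$ carries the $\sigma$-algebra (and topology) induced by that of $(\mathcal{F},D_\infty)$, and $\mu$ is a probability measure on $\mathcal{I}$ which is non-degenerate, i.e. the support of $\mu$ is $\mathcal{I}$. $\mu^{\mathbb{N}}$ is the product measure on $\mathcal{I}^{\mathbb{N}}$. For $\mathbf{i}=(i_1,i_2,\ldots)\in\mathcal{I}^{\mathbb{N}}$ and $n\in\mathbb{N}$ put $f_{\mathbf{i}}^n=f_{i_n}\circ\cdots\circ f_{i_1}$, $X_n^x(\mathbf{i})=f_{\mathbf{i}}^n(x)$,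 $X_0^x(\mathbf{i})=x$. $D^\alpha(x,y)$ means $(D(x,y))^\alpha$. Proximal: for every $x,y\in M$ there exist $\mathbf{i}\in\mathcal{I}^{\mathbb{N}}$ and a (strictly increasing) sequence $(n_k)_{k}$ with $\lim_{k\to\infty}D(f_{\mathbf{i}}^{n_k}(x),f_{\mathbf{i}}^{n_k}(y))=0$. Local contraction property with local contraction rate $q\in(0,1)$: for every $x\in M$, for $\mu^{\mathbb{N}}$-almost every $\mathbf{i}\in\mathcal{I}^{\mathbb{N}}$ there exists a neighborhood $B$ of $x$ such that $\operatorname{diam}_D(f_{\mathbf{i}}^n(B))\le q^n$ for all $n\in\mathbb{N}$. *)

theory Defs
  imports "HOL-Probability.Probability"
begin

(* C^0(M) is the type 'm \<Rightarrow>\<^sub>C 'm of bounded continuous maps with its supremum distance: for compact M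
   every continuous self-map of M is bounded. *)

definition index_topology :: "('i \<Rightarrow> ('m::metric_space \<Rightarrow>\<^sub>C 'm)) \<Rightarrow> 'i set \<Rightarrow> 'i topology" where
  "index_topology f I = pullback_topology I f euclidean"

definition topological_support :: "'i topology \<Rightarrow> 'i measure \<Rightarrow> 'i set" where
  "topological_support T \<mu> = {i \<in> topspace T. \<forall>U. openin T U \<and> i \<in> U \<longrightarrow> 0 < emeasure \<mu> U}"

(* The index set is space \<mu>; the family f need not be injective. *)
definition random_dynamical_system ::
    "('i \<Rightarrow> ('m::metric_space \<Rightarrow>\<^sub>C 'm)) \<Rightarrow> 'i measure \<Rightarrow> bool" where
  "random_dynamical_system f \<mu> \<longleftrightarrow>
     prob_space \<mu> \<and>
     sets \<mu> = sets (vimage_algebra (space \<mu>) f borel) \<and>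
     topological_support (index_topology f (space \<mu>)) \<mu> = space \<mu>"

(* Sequences are indexed from 0, so \<omega> n is the (n+1)-st entry of (i_1, i_2, ...). *)
primrec random_iterate ::
    "('i \<Rightarrow> ('m::metric_space \<Rightarrow>\<^sub>C 'm)) \<Rightarrow> (nat \<Rightarrow> 'i) \<Rightarrow> nat \<Rightarrow> 'm \<Rightarrow> 'm" where
  "random_iterate f \<omega> 0 = id"
| "random_iterate f \<omega> (Suc n) = apply_bcontfun (f (\<omega> n)) \<circ> random_iterate f \<omega> n"

abbreviation random_orbit ::
    "('i \<Rightarrow> ('m::metric_space \<Rightarrow>\<^sub>C 'm)) \<Rightarrow> nat \<Rightarrow> 'm \<Rightarrow> (nat \<Rightarrow> 'i) \<Rightarrow> 'm" where
  "random_orbit f n x \<omega> \<equiv> random_iterate f \<omega> n x"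

abbreviation sequence_measure :: "'i measure \<Rightarrow> (nat \<Rightarrow> 'i) measure" where
  "sequence_measure \<mu> \<equiv> PiM UNIV (\<lambda>_. \<mu>)"

definition proximal :: "('i \<Rightarrow> ('m::metric_space \<Rightarrow>\<^sub>C 'm)) \<Rightarrow> 'i set \<Rightarrow> bool" where
  "proximal f I \<longleftrightarrow>
     (\<forall>x y. \<exists>\<omega> r. range \<omega> \<subseteq> I \<and> strict_mono (r :: nat \<Rightarrow> nat) \<and>
        (\<lambda>k. dist (random_iterate f \<omega> (r k) x) (random_iterate f \<omega> (r k) y)) \<longlonglongrightarrow> 0)"

definition local_contraction ::
    "('i \<Rightarrow> ('m::metric_space \<Rightarrow>\<^sub>C 'm)) \<Rightarrow> 'i measure \<Rightarrow> real \<Rightarrow> bool" where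
  "local_contraction f \<mu> q \<longleftrightarrow>
     (\<forall>x. AE \<omega> in sequence_measure \<mu>.
        \<exists>B. x \<in> interior B \<and> (\<forall>n\<ge>1. diameter (random_iterate f \<omega> n ` B) \<le> q ^ n))"

end

(* The right-hand side is at least C, so it suffices to bound the sums by a constant. Let u_n be the
   supremum of the sums over all starting pairs. Call a pair good if near it the sums are at most
   K + eta * u_n with K and eta < 1 independent of n. Local contraction makes diagonal pairs good: with
   probability at least 1/2 the sum is dominated by a geometric series, and otherwise the process is
   restarted at the first time the domination fails. By non-degeneracy a pair is good as soon as one
   of its images under some f_i is good, so by proximality every pair is good. Compactness gives
   uniform K and eta < 1, whence u_n <= K / (1 - eta). *)

theory Submission
  imports Defs
begin

section \<open>Separability of compact spaces and measurability of random evaluations\<close>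

text \<open>Total boundedness gives a finite net for each radius 1/(n+1). The union of these nets is
  countable, and an enumeration of it is dense.\<close>

lemma compact_dense_sequence:
  assumes "compact (UNIV :: 'a::metric_space set)"
  obtains d :: "nat \<Rightarrow> 'a::metric_space" where "\<And>x e. 0 < e \<Longrightarrow> \<exists>k. dist x (d k) < e"
proof -
  have "\<forall>n::nat. \<exists>N::'a set. finite N \<and> UNIV \<subseteq> (\<Union>x\<in>N. ball x (inverse (Suc n)))"
    using assms by (simp add: compact_eq_totally_bounded)
  then obtain N :: "nat \<Rightarrow> 'a set" where fin: "\<And>n. finite (N n)"
    and cover: "\<And>n. UNIV \<subseteq> (\<Union>x\<in>N n. ball x (inverse (Suc n)))"
    by metis
  have count: "countable (\<Union>n. N n)"
    using fin by (auto intro: countable_finite)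
  have "N 0 \<noteq> {}" using cover[of 0] by force
  then have "(\<Union>n. N n) \<noteq> {}" by blast
  with count have range: "range (from_nat_into (\<Union>n. N n)) = (\<Union>n. N n)"
    by (metis range_from_nat_into)
  show thesis
  proof
    fix x :: 'a and e :: real assume "0 < e"
    then obtain n where n: "inverse (Suc n) < e" using reals_Archimedean by blast
    obtain y where "y \<in> N n" "dist y x < inverse (Suc n)" using cover[of n] by (auto simp: subset_eq)
    moreover from this range obtain k where "y = from_nat_into (\<Union>n. N n) k"
      by (metis UN_I UNIV_I imageE)
    ultimately show "\<exists>k. dist x (from_nat_into (\<Union>n. N n) k) < e"
      using n by (metis dist_commute less_trans)
  qed
qed

text \<open>The type need not be second countable as a class, so the product \<open>\<sigma>\<close>-algebra of two Borel
  algebras is not available; instead \<open>X\<close> is approximated by maps with values in a countable set.\<close>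
lemma borel_measurable_Caratheodory:
  fixes F :: "'w \<Rightarrow> 'a::metric_space \<Rightarrow> 'b::metric_space"
  assumes "compact (UNIV :: 'a set)"
    and F: "\<And>a. (\<lambda>w. F w a) \<in> borel_measurable M"
    and cont: "\<And>w. w \<in> space M \<Longrightarrow> continuous_on UNIV (F w)"
    and X[measurable]: "X \<in> borel_measurable M"
  shows "(\<lambda>w. F w (X w)) \<in> borel_measurable M"
proof -
  obtain d :: "nat \<Rightarrow> 'a" where d: "\<And>x e. 0 < e \<Longrightarrow> \<exists>k. dist x (d k) < e"
    using compact_dense_sequence[OF assms(1)] by blast
  \<comment> \<open>Taking the first admissible index makes the choice of the approximating point
    Borel in \<open>x\<close>.\<close>
  define s where "s n x = (LEAST k. dist x (d k) < inverse (Suc n))" for n :: nat and x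
  have s: "dist x (d (s n x)) < inverse (Suc n)" for n x
    unfolding s_def by (rule LeastI_ex) (auto intro!: d)
  have ball[measurable]: "Measurable.pred borel (\<lambda>x. dist x (d k) < e)" for k e
  proof -
    have "{x. dist x (d k) < e} = ball (d k) e" by (auto simp: dist_commute)
    then show ?thesis by (simp add: pred_def)
  qed
  have [measurable]: "s n \<in> measurable borel (count_space UNIV)" for n
    unfolding s_def by measurable
  have "(\<lambda>w. F w (d (s n (X w)))) \<in> borel_measurable M" for n
    by (rule measurable_compose_countable[where f="\<lambda>k w. F w (d k)" and g="\<lambda>w. s n (X w)"])
      (use F in measurable)
  then show ?thesis
  proof (rule borel_measurable_LIMSEQ_metric)
    fix w assume w: "w \<in> space M"
    have "(\<lambda>n. dist (d (s n (X w))) (X w)) \<longlonglongrightarrow> 0"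
      by (rule tendsto_sandwich[OF _ _ tendsto_const LIMSEQ_inverse_real_of_nat])
        (use s[of "X w"] in \<open>auto simp: dist_commute intro!: always_eventually less_imp_le\<close>)
    then have "(\<lambda>n. d (s n (X w))) \<longlonglongrightarrow> X w"
      by (rule tendsto_dist_iff[THEN iffD2])
    then show "(\<lambda>n. F w (d (s n (X w)))) \<longlonglongrightarrow> F w (X w)"
      by (rule continuous_on_tendsto_compose[OF cont[OF w]]) auto
  qed
qed

section \<open>Accumulated cost along random orbits\<close>

text \<open>Later the state is a pair of points moved by the same map, and the cost
  \<open>\<phi>\<close> is a power of their distance. Non-degeneracy enters through
  \<open>F_near\<close>: a transition into an open set persists with positive probability, uniformly
  for nearby starting points.\<close>

locale random_maps = sequence_space \<mu> for \<mu> :: "'i measure" +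
  fixes F :: "'i \<Rightarrow> 'a::metric_space \<Rightarrow> 'a"
    and \<phi> :: "'a \<Rightarrow> real" and \<Delta> :: real
  assumes compact_UNIV: "compact (UNIV :: 'a set)"
    and F_measurable: "\<And>a. (\<lambda>i. F i a) \<in> borel_measurable \<mu>"
    and F_continuous: "\<And>i. i \<in> space \<mu> \<Longrightarrow> continuous_on UNIV (F i)"
    and \<phi>_measurable[measurable]: "\<phi> \<in> borel_measurable borel"
    and \<phi>_nonneg: "\<And>a. 0 \<le> \<phi> a" and \<phi>_le: "\<And>a. \<phi> a \<le> \<Delta>"
    and F_near: "\<And>i a W. i \<in> space \<mu> \<Longrightarrow> open W \<Longrightarrow> F i a \<in> W \<Longrightarrow>
      \<exists>V W'. V \<in> sets \<mu> \<and> 0 < measure \<mu> V \<and> open W' \<and> a \<in> W' \<and> (\<forall>j\<in>V. \<forall>b\<in>W'. F j b \<in> W)"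
begin

primrec orbit :: "(nat \<Rightarrow> 'i) \<Rightarrow> nat \<Rightarrow> 'a \<Rightarrow> 'a" where
  "orbit \<omega> 0 a = a"
| "orbit \<omega> (Suc n) a = F (\<omega> n) (orbit \<omega> n a)"

lemma orbit_case_nat: "orbit (case_nat i \<omega>) (Suc n) a = orbit \<omega> n (F i a)"
  by (induction n) auto

lemma orbit_measurable[measurable]: "(\<lambda>\<omega>. orbit \<omega> n a) \<in> borel_measurable S"
proof (induction n)
  case (Suc n)
  have "(\<lambda>\<omega>. F (\<omega> n) (orbit \<omega> n a)) \<in> borel_measurable S"
  proof (rule borel_measurable_Caratheodory[OF compact_UNIV _ _ Suc])
    show "(\<lambda>\<omega>. F (\<omega> n) b) \<in> borel_measurable S" for b
      by (rule measurable_compose[OF _ F_measurable]) measurable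
    show "continuous_on UNIV (F (\<omega> n))" if "\<omega> \<in> space S" for \<omega>
      using that by (intro F_continuous) (auto simp: space_PiM PiE_iff)
  qed
  then show ?case by simp
qed simp

text \<open>Prepending an independent index to a random sequence preserves its law
  (\<open>PiM_iter\<close>), and Fubini applies because \<open>h\<close> is bounded. This is the
  Markov property behind \<open>total_Suc\<close> and \<open>escape_Suc\<close>.\<close>

lemma integral_shift:
  fixes h :: "(nat \<Rightarrow> 'i) \<Rightarrow> real"
  assumes [measurable]: "h \<in> borel_measurable S" and bound: "\<And>\<omega>. \<bar>h \<omega>\<bar> \<le> B"
  shows "integrable \<mu> (\<lambda>i. \<integral>\<omega>. h (case_nat i \<omega>) \<partial>S)"
    and "(\<integral>\<omega>. h \<omega> \<partial>S) = (\<integral>i. (\<integral>\<omega>. h (case_nat i \<omega>) \<partial>S) \<partial>\<mu>)"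
proof -
  interpret Q: pair_prob_space \<mu> S ..
  have int: "integrable (\<mu> \<Otimes>\<^sub>M S) (\<lambda>(i, \<omega>). h (case_nat i \<omega>))"
    by (rule Q.P.integrable_const_bound[where B=B]) (auto simp: bound split_beta')
  show "integrable \<mu> (\<lambda>i. \<integral>\<omega>. h (case_nat i \<omega>) \<partial>S)"
    using Q.integrable_fst'[OF int] by simp
  have "(\<integral>\<omega>. h \<omega> \<partial>S) = (\<integral>\<omega>. h \<omega> \<partial>distr (\<mu> \<Otimes>\<^sub>M S) S (\<lambda>(i, \<omega>). case_nat i \<omega>))"
    by (simp only: PiM_iter)
  also have "\<dots> = (\<integral>p. h (case p of (i, \<omega>) \<Rightarrow> case_nat i \<omega>) \<partial>(\<mu> \<Otimes>\<^sub>M S))"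
    by (rule integral_distr) measurable
  also have "\<dots> = (\<integral>i. (\<integral>\<omega>. h (case_nat i \<omega>) \<partial>S) \<partial>\<mu>)"
    using Q.integral_fst'[OF int] by (simp add: split_beta')
  finally show "(\<integral>\<omega>. h \<omega> \<partial>S) = (\<integral>i. (\<integral>\<omega>. h (case_nat i \<omega>) \<partial>S) \<partial>\<mu>)" .
qed

definition total :: "nat \<Rightarrow> 'a \<Rightarrow> real" where
  "total n a = (\<Sum>k\<le>n. \<integral>\<omega>. \<phi> (orbit \<omega> k a) \<partial>S)"

text \<open>The horizon \<open>n\<close> is finite so that one step of the orbit lowers
  \<open>n\<close> and shifts \<open>c\<close>, which makes induction on \<open>n\<close>
  possible.\<close>

definition escape :: "(nat \<Rightarrow> real) \<Rightarrow> nat \<Rightarrow> 'a \<Rightarrow> real" where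
  "escape c n a = measure S {\<omega> \<in> space S. \<exists>m\<le>n. c m < \<phi> (orbit \<omega> m a)}"

lemma orbit_integral_bounds: "0 \<le> (\<integral>\<omega>. \<phi> (orbit \<omega> k a) \<partial>S)" "(\<integral>\<omega>. \<phi> (orbit \<omega> k a) \<partial>S) \<le> \<Delta>"
proof -
  show "0 \<le> (\<integral>\<omega>. \<phi> (orbit \<omega> k a) \<partial>S)" by (simp add: \<phi>_nonneg)
  have "integrable S (\<lambda>\<omega>. \<phi> (orbit \<omega> k a))"
    by (rule P.integrable_const_bound[where B=\<Delta>]) (auto simp: \<phi>_nonneg \<phi>_le)
  then show "(\<integral>\<omega>. \<phi> (orbit \<omega> k a) \<partial>S) \<le> \<Delta>"
    by (intro P.integral_le_const) (auto simp: \<phi>_le)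
qed

lemma total_nonneg: "0 \<le> total n a"
  unfolding total_def by (intro sum_nonneg orbit_integral_bounds)

lemma total_le: "total n a \<le> (Suc n) * \<Delta>"
  unfolding total_def
  using sum_bounded_above[of "{..n}", OF orbit_integral_bounds(2)] by simp

lemma total_0: "total 0 a = \<phi> a"
  by (simp add: total_def P.prob_space)

lemma total_mono: "n \<le> m \<Longrightarrow> total n a \<le> total m a"
  unfolding total_def by (intro sum_mono2 orbit_integral_bounds) auto

lemma total_Suc:
  shows "integrable \<mu> (\<lambda>i. total n (F i a))"
    and "total (Suc n) a = \<phi> a + (\<integral>i. total n (F i a) \<partial>\<mu>)"
proof -
  have h: "integrable \<mu> (\<lambda>i. \<integral>\<omega>. \<phi> (orbit \<omega> k (F i a)) \<partial>S)"
    "(\<integral>\<omega>. \<phi> (orbit \<omega> (Suc k) a) \<partial>S) = (\<integral>i. (\<integral>\<omega>. \<phi> (orbit \<omega> k (F i a)) \<partial>S) \<partial>\<mu>)" for k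
    using integral_shift[of "\<lambda>\<omega>. \<phi> (orbit \<omega> (Suc k) a)" \<Delta>, unfolded orbit_case_nat]
      orbit_measurable[of "Suc k" a] \<phi>_nonneg \<phi>_le
    by (auto simp del: orbit.simps)
  show "integrable \<mu> (\<lambda>i. total n (F i a))"
    unfolding total_def by (intro Bochner_Integration.integrable_sum h)
  have "total (Suc n) a = \<phi> a + (\<Sum>k\<le>n. \<integral>\<omega>. \<phi> (orbit \<omega> (Suc k) a) \<partial>S)"
    unfolding total_def by (subst sum.atMost_Suc_shift) (simp add: P.prob_space)
  then show "total (Suc n) a = \<phi> a + (\<integral>i. total n (F i a) \<partial>\<mu>)"
    unfolding total_def h(2) by (simp add: h(1))
qed

text \<open>With the threshold at time 0 respected, a violation can only occur after the first step.
  Conditioning on the first index then leaves the same event for the image point, with thresholds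
  shifted by one.\<close>

lemma escape_Suc:
  assumes "\<phi> a \<le> c 0"
  shows "integrable \<mu> (\<lambda>i. escape (\<lambda>m. c (Suc m)) n (F i a))"
    and "escape c (Suc n) a = (\<integral>i. escape (\<lambda>m. c (Suc m)) n (F i a) \<partial>\<mu>)"
proof -
  let ?E = "{\<omega> \<in> space S. \<exists>m\<le>Suc n. c m < \<phi> (orbit \<omega> m a)}"
  let ?E' = "\<lambda>i. {\<omega> \<in> space S. \<exists>m\<le>n. c (Suc m) < \<phi> (orbit \<omega> m (F i a))}"
  have [measurable]: "?E \<in> sets S" "?E' i \<in> sets S" for i
    using orbit_measurable by measurable
  have ex: "(\<exists>m\<le>Suc n. c m < \<phi> (orbit (case_nat i \<omega>) m a)) \<longleftrightarrow>
      (\<exists>m\<le>n. c (Suc m) < \<phi> (orbit \<omega> m (F i a)))" for i \<omega>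
  proof -
    have "(\<exists>m\<le>Suc n. P m) \<longleftrightarrow> P 0 \<or> (\<exists>m\<le>n. P (Suc m))" for P
      by (metis Suc_le_mono le0 not0_implies_Suc)
    then show ?thesis using assms by (simp only: orbit_case_nat) auto
  qed
  have "case_nat i \<omega> \<in> space S \<longleftrightarrow> \<omega> \<in> space S" if "i \<in> space \<mu>" for i \<omega>
    using that by (auto simp: space_PiM PiE_iff split: nat.splits)
  with ex have "indicator ?E (case_nat i \<omega>) = (indicator (?E' i) \<omega> :: real)" if "i \<in> space \<mu>" for i \<omega>
    using that by (simp add: indicator_def)
  then have eq: "(\<integral>\<omega>. indicator ?E (case_nat i \<omega>) \<partial>S) = escape (\<lambda>m. c (Suc m)) n (F i a)"
    if "i \<in> space \<mu>" for i
    using that by (simp add: escape_def)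
  have "indicator ?E \<in> borel_measurable S" by measurable
  note shift = integral_shift[OF this, of 1]
  show "integrable \<mu> (\<lambda>i. escape (\<lambda>m. c (Suc m)) n (F i a))"
    using shift(1) eq by (subst Bochner_Integration.integrable_cong[OF refl eq[symmetric]]) (auto simp: indicator_def)
  have "escape c (Suc n) a = (\<integral>\<omega>. indicator ?E \<omega> \<partial>S)" by (simp add: escape_def)
  also have "\<dots> = (\<integral>i. escape (\<lambda>m. c (Suc m)) n (F i a) \<partial>\<mu>)"
    using shift(2) eq by (simp add: indicator_def cong: Bochner_Integration.integral_cong)
  finally show "escape c (Suc n) a = (\<integral>i. escape (\<lambda>m. c (Suc m)) n (F i a) \<partial>\<mu>)" .
qed

text \<open>Running the orbit until it first exceeds the thresholds \<open>c\<close> and restarting there: the cost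
  before that time is at most the sum of the thresholds, the cost afterwards at most \<open>U\<close>.\<close>
lemma total_le_escape:
  assumes "\<And>m. 0 \<le> c m" and "\<And>b. total n b \<le> U"
  shows "total n a \<le> (\<Sum>m\<le>n. c m) + U * escape c n a"
  using assms
proof (induction n arbitrary: c a)
  case (Suc n)
  have "0 \<le> U" using Suc.prems(2) total_nonneg order_trans by blast
  show ?case
  proof (cases "\<phi> a \<le> c 0")
    case True
    \<comment> \<open>The bound \<open>U\<close> on sums up to \<open>Suc n\<close> also bounds sums
      up to \<open>n\<close>, so the same \<open>U\<close> serves in the induction
      hypothesis.\<close>
    have IH: "total n (F i a) \<le> (\<Sum>m\<le>n. c (Suc m)) + U * escape (\<lambda>m. c (Suc m)) n (F i a)" for i
      using Suc.prems total_mono[of n "Suc n"] order_trans by (intro Suc.IH) fastforce+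
    have "total (Suc n) a = \<phi> a + (\<integral>i. total n (F i a) \<partial>\<mu>)" by (rule total_Suc)
    also have "\<dots> \<le> c 0 + (\<integral>i. (\<Sum>m\<le>n. c (Suc m)) + U * escape (\<lambda>m. c (Suc m)) n (F i a) \<partial>\<mu>)"
      by (intro add_mono True integral_mono total_Suc IH Bochner_Integration.integrable_add
          integrable_mult_right escape_Suc) auto
    also have "\<dots> = (\<Sum>m\<le>Suc n. c m) + U * escape c (Suc n) a"
      using escape_Suc[of a c n] True
      by (subst sum.atMost_Suc_shift) (simp add: M.prob_space)
    finally show ?thesis .
  next
    \<comment> \<open>The violation happens at time 0 with certainty, so the restart term
      \<open>U\<close> alone covers the whole sum.\<close>
    case False
    then have "escape c (Suc n) a = 1"
      unfolding escape_def
      by (subst P.prob_space[symmetric], intro arg_cong[where f="measure S"]) force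
    then show ?thesis using Suc.prems by (simp add: add_increasing sum_nonneg del: sum.atMost_Suc)
  qed
next
  case 0
  show ?case
  proof (cases "\<phi> a \<le> c 0")
    case True
    have "0 \<le> U" using 0(2) total_nonneg order_trans by blast
    with True show ?thesis by (simp add: total_0 escape_def)
  next
    case False
    then have "escape c 0 a = 1" unfolding escape_def by (simp add: P.prob_space)
    then show ?thesis using 0 by (simp add: add_increasing)
  qed
qed

section \<open>Good points: local affine bounds on the cost, and their propagation\<close>

text \<open>Using an arbitrary common bound \<open>U\<close> in place of the supremum lets one
  \<open>U\<close> serve for shorter horizons too. The neighbourhood \<open>W\<close> makes goodness
  an open condition and prepares the compactness argument.\<close>

definition good :: "'a \<Rightarrow> bool" where
  "good a \<longleftrightarrow> (\<exists>K \<eta> W. 0 \<le> \<eta> \<and> \<eta> < 1 \<and> open W \<and> a \<in> W \<and>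
     (\<forall>b\<in>W. \<forall>n U. (\<forall>x. total n x \<le> U) \<longrightarrow> total n b \<le> K + \<eta> * U))"

lemma open_good: "open {a. good a}"
proof (subst open_subopen, intro ballI)
  fix a assume "a \<in> {a. good a}"
  then obtain K \<eta> W where W: "0 \<le> \<eta>" "\<eta> < 1" "open W" "a \<in> W"
    "\<forall>b\<in>W. \<forall>n U. (\<forall>x. total n x \<le> U) \<longrightarrow> total n b \<le> K + \<eta> * U"
    unfolding good_def by auto
  then have "W \<subseteq> {a. good a}" unfolding good_def by auto
  with W show "\<exists>T. open T \<and> a \<in> T \<and> T \<subseteq> {a. good a}" by auto
qed

text \<open>With probability at least p = \<open>measure \<mu> V\<close> the first step lands in
  \<open>W\<close>, where the bound \<open>K + \<eta> * U\<close> holds; otherwise the remaining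
  cost is at most \<open>U\<close>. Averaging replaces the factor \<open>\<eta>\<close> by
  \<open>1 - p * (1 - \<eta>)\<close>, which is still below 1.\<close>

lemma good_preimage:
  assumes i: "i \<in> space \<mu>" and "good (F i a)"
  shows "good a"
proof -
  obtain K \<eta> W where "0 \<le> \<eta>" "\<eta> < 1" "open W" "F i a \<in> W"
    and W: "\<And>b n U. b \<in> W \<Longrightarrow> (\<forall>x. total n x \<le> U) \<Longrightarrow> total n b \<le> K + \<eta> * U"
    using assms(2) unfolding good_def by blast
  obtain V W' where V: "V \<in> sets \<mu>" "0 < measure \<mu> V" "open W'" "a \<in> W'"
    and near: "\<And>j b. j \<in> V \<Longrightarrow> b \<in> W' \<Longrightarrow> F j b \<in> W"
    using F_near[OF i \<open>open W\<close> \<open>F i a \<in> W\<close>] by blast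
  let ?p = "measure \<mu> V"
  \<comment> \<open>Here \<open>\<Delta>\<close> pays for time 0. Since \<open>K\<close> may be
    negative, it is replaced by its absolute value, so that dropping the factor \<open>?p\<close> in
    front of it only enlarges the bound.\<close>
  have "total n b \<le> (\<Delta> + \<bar>K\<bar>) + (1 - ?p * (1 - \<eta>)) * U"
    if b: "b \<in> W'" and U: "\<forall>x. total n x \<le> U" for b n U
  proof -
    have "0 \<le> U" using U total_nonneg order_trans by blast
    have p: "0 \<le> ?p" "?p \<le> 1" by auto
    show ?thesis
    proof (cases n)
      case 0
      have "?p * (1 - \<eta>) \<le> 1"
        using p \<open>0 \<le> \<eta>\<close> \<open>\<eta> < 1\<close> by (intro mult_le_one) auto
      then have "0 \<le> (1 - ?p * (1 - \<eta>)) * U" using \<open>0 \<le> U\<close> by simp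
      then show ?thesis using \<phi>_le[of b] by (simp add: 0 total_0)
    next
      case (Suc m)
      have U': "\<forall>x. total m x \<le> U" using U total_mono[of m n] Suc order_trans by (metis le_SucI order_refl)
      have le: "total m (F j b) \<le> U + indicator V j * (\<bar>K\<bar> - (1 - \<eta>) * U)" for j
        using U' W[OF near[of j b], of m U] b by (auto simp: indicator_def algebra_simps)
      have "total n b = \<phi> b + (\<integral>j. total m (F j b) \<partial>\<mu>)" unfolding Suc by (rule total_Suc)
      also have "\<dots> \<le> \<Delta> + (\<integral>j. U + indicator V j * (\<bar>K\<bar> - (1 - \<eta>) * U) \<partial>\<mu>)"
        using V by (intro add_mono \<phi>_le integral_mono total_Suc le Bochner_Integration.integrable_add
            integrable_mult_left integrable_real_indicator) (auto simp: less_top[symmetric])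
      also have "\<dots> = \<Delta> + U + ?p * (\<bar>K\<bar> - (1 - \<eta>) * U)"
        using V by (subst Bochner_Integration.integral_add)
          (auto simp: less_top[symmetric] M.prob_space intro!: integrable_mult_left)
      also have "\<dots> \<le> (\<Delta> + \<bar>K\<bar>) + (1 - ?p * (1 - \<eta>)) * U"
        using mult_right_mono[OF p(2), of "\<bar>K\<bar>"] by (simp add: algebra_simps)
      finally show ?thesis .
    qed
  qed
  moreover have "1 - ?p * (1 - \<eta>) < 1" using V \<open>\<eta> < 1\<close> by simp
  moreover have "0 \<le> 1 - ?p * (1 - \<eta>)"
    using \<open>0 \<le> \<eta>\<close> \<open>\<eta> < 1\<close> mult_le_one[of ?p "1 - \<eta>"] by simp
  ultimately show ?thesis
    unfolding good_def using V
    by (intro exI[of _ "\<Delta> + \<bar>K\<bar>"] exI[of _ "1 - ?p * (1 - \<eta>)"] exI[of _ W']) blast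
qed

lemma good_orbit:
  assumes "\<And>n. \<omega> n \<in> space \<mu>" and "good (orbit \<omega> n a)"
  shows "good a"
  using assms(2) by (induction n) (auto intro: good_preimage assms(1))

text \<open>The neighbourhood in the hypothesis depends on \<open>\<omega>\<close>, so it is traded
  for a probability. Along any sequence tending to \<open>a\<close>, the indicators of the violation
  events are almost surely eventually 0. By dominated convergence, these events have probability at
  most 1/2 throughout some ball around \<open>a\<close>. There \<open>total_le_escape\<close> gives
  the constants \<open>suminf c\<close> and 1/2.\<close>

lemma good_if_locally_dominated:
  assumes c: "\<And>m. 0 \<le> c m" "summable c"
    and AE: "AE \<omega> in S. \<exists>W. open W \<and> a \<in> W \<and> (\<forall>b\<in>W. \<forall>m. \<phi> (orbit \<omega> m b) \<le> c m)"
  shows "good a"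
proof -
  define bad where "bad b = {\<omega> \<in> space S. \<exists>m. c m < \<phi> (orbit \<omega> m b)}" for b
  have bad_sets[measurable]: "bad b \<in> sets S" for b
    unfolding bad_def by measurable
  have "\<exists>k::nat. \<forall>b\<in>ball a (inverse (Suc k)). measure S (bad b) \<le> 1/2"
  proof (rule ccontr)
    assume "\<not> ?thesis"
    then have "\<forall>k::nat. \<exists>b. dist a b < inverse (Suc k) \<and> 1/2 < measure S (bad b)"
      by (fastforce simp: not_le)
    then obtain b where b: "\<And>k::nat. dist a (b k) < inverse (Suc k)" "\<And>k. 1/2 < measure S (bad (b k))"
      by metis
    have "(\<lambda>k. dist (b k) a) \<longlonglongrightarrow> 0"
      by (rule tendsto_sandwich[OF _ _ tendsto_const LIMSEQ_inverse_real_of_nat])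
        (use b(1) in \<open>auto simp: dist_commute intro!: always_eventually less_imp_le\<close>)
    then have "b \<longlonglongrightarrow> a"
      by (rule tendsto_dist_iff[THEN iffD2])
    have "(\<lambda>k. \<integral>\<omega>. indicator (bad (b k)) \<omega> \<partial>S) \<longlonglongrightarrow> (\<integral>\<omega>. (0::real) \<partial>S)"
    proof (rule integral_dominated_convergence[where w="\<lambda>_. 1"])
      show "AE \<omega> in S. (\<lambda>k. indicator (bad (b k)) \<omega>) \<longlonglongrightarrow> (0::real)"
        using AE
      proof eventually_elim
        case (elim \<omega>)
        then obtain W where W: "open W" "a \<in> W" "\<And>b m. b \<in> W \<Longrightarrow> \<phi> (orbit \<omega> m b) \<le> c m" by blast
        have "\<forall>\<^sub>F k in sequentially. b k \<in> W"
          by (rule topological_tendstoD[OF \<open>b \<longlonglongrightarrow> a\<close> W(1,2)])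
        then have "\<forall>\<^sub>F k in sequentially. indicator (bad (b k)) \<omega> = (0::real)"
          by eventually_elim (use W(3) in \<open>auto simp: bad_def not_less indicator_def\<close>)
        then show ?case by (rule tendsto_eventually)
      qed
    qed (auto simp: indicator_def)
    then have "(\<lambda>k. measure S (bad (b k))) \<longlonglongrightarrow> 0" by simp
    then have "\<forall>\<^sub>F k in sequentially. measure S (bad (b k)) < 1/2"
      by (rule order_tendstoD) simp
    then show False using b(2) by (auto simp: eventually_sequentially dest: less_asym)
  qed
  then obtain k :: nat where k: "\<And>b. b \<in> ball a (inverse (Suc k)) \<Longrightarrow> measure S (bad b) \<le> 1/2" by blast
  have "total n b \<le> suminf c + 1/2 * U"
    if b: "b \<in> ball a (inverse (Suc k))" and U: "\<forall>x. total n x \<le> U" for b n U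
  proof -
    have "0 \<le> U" using U total_nonneg order_trans by blast
    have "escape c n b \<le> measure S (bad b)"
      unfolding escape_def by (rule P.finite_measure_mono) (auto simp: bad_def[symmetric], auto simp: bad_def)
    then have "U * escape c n b \<le> U * (1/2)"
      using k[OF b] \<open>0 \<le> U\<close> by (intro mult_left_mono) auto
    moreover have "(\<Sum>m\<le>n. c m) \<le> suminf c"
      using c by (intro sum_le_suminf) auto
    moreover have "total n b \<le> (\<Sum>m\<le>n. c m) + U * escape c n b"
      using c(1) U by (intro total_le_escape) auto
    ultimately show ?thesis by simp
  qed
  then show ?thesis unfolding good_def
    by (intro exI[of _ "suminf c"] exI[of _ "1/2"] exI[of _ "ball a (inverse (Suc k))"]) simp
qed

text \<open>A finite subcover reduces the local constants to their maxima \<open>k\<close> and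
  \<open>h\<close>, with \<open>h < 1\<close>. The supremum of the sums then satisfies an affine
  inequality whose solution is independent of \<open>n\<close>.\<close>

lemma total_bounded:
  assumes "\<And>a. good a"
  obtains C where "0 < C" and "\<And>n a. total n a \<le> C"
proof -
  have "\<forall>a. \<exists>K \<eta> W. 0 \<le> \<eta> \<and> \<eta> < 1 \<and> open W \<and> a \<in> W \<and>
      (\<forall>b\<in>W. \<forall>n U. (\<forall>x. total n x \<le> U) \<longrightarrow> total n b \<le> K + \<eta> * U)"
    using assms unfolding good_def by simp
  then obtain K \<eta> W where \<eta>: "\<And>a. \<eta> a < 1" and W: "\<And>a. open (W a)" "\<And>a. a \<in> W a"
    and le: "\<And>a b n U. b \<in> W a \<Longrightarrow> (\<forall>x. total n x \<le> U) \<Longrightarrow> total n b \<le> K a + \<eta> a * U"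
    by metis
  obtain A where A: "finite A" "UNIV \<subseteq> (\<Union>a\<in>A. W a)"
  proof (rule compactE_image[OF compact_UNIV, of UNIV W])
    show "UNIV \<subseteq> (\<Union>a. W a)" using W(2) by blast
  qed (use W(1) that in auto)
  then have "A \<noteq> {}" by auto
  define k h where "k = Max (K ` A)" and "h = Max (\<eta> ` A)"
  have "h < 1" unfolding h_def using A \<open>A \<noteq> {}\<close> \<eta> by simp
  have bound: "total n a \<le> k / (1 - h)" for n a
  proof -
    \<comment> \<open>For fixed \<open>n\<close> this supremum is finite by the crude bound
      \<open>total_le\<close>, which is what permits solving \<open>U \<le> k + h * U\<close> for
      \<open>U\<close>.\<close>
    define U where "U = (SUP b. total n b)"
    have "bdd_above (range (total n))"
      using total_le by (intro bdd_aboveI[of _ "Suc n * \<Delta>"]) auto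
    then have U: "total n b \<le> U" for b unfolding U_def by (intro cSUP_upper) auto
    then have "0 \<le> U" using total_nonneg order_trans by blast
    have "total n b \<le> k + h * U" for b
    proof -
      obtain a where a: "a \<in> A" "b \<in> W a" using A by auto
      have "total n b \<le> K a + \<eta> a * U" using le a U by blast
      also have "\<dots> \<le> k + h * U" unfolding k_def h_def
        using a A \<open>0 \<le> U\<close> by (intro add_mono mult_right_mono Max_ge) auto
      finally show ?thesis .
    qed
    then have "U \<le> k + h * U" unfolding U_def by (intro cSUP_least) auto
    then have "U \<le> k / (1 - h)" using \<open>h < 1\<close> by (simp add: field_simps)
    then show ?thesis using U order_trans by blast
  qed
  show thesis
    by (rule that[of "max 1 (k / (1 - h))"]) (auto intro: order_trans[OF bound])
qed

end

section \<open>The pair process of the random dynamical system\<close>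

text \<open>Evaluation is jointly continuous for the supremum distance: the error splits into the
  distance of the two maps and the variation of the fixed map \<open>g z\<close> along
  \<open>h\<close>.\<close>

lemma continuous_on_bcontfun_apply:
  fixes g :: "'z::topological_space \<Rightarrow> ('a::topological_space \<Rightarrow>\<^sub>C 'b::metric_space)"
  assumes "continuous_on A g" "continuous_on A h"
  shows "continuous_on A (\<lambda>z. apply_bcontfun (g z) (h z))"
  unfolding continuous_on_def
proof
  fix z assume "z \<in> A"
  with assms have g: "(g \<longlongrightarrow> g z) (at z within A)" and h: "(h \<longlongrightarrow> h z) (at z within A)"
    by (auto simp: continuous_on_def)
  have "((\<lambda>w. apply_bcontfun (g z) (h w)) \<longlongrightarrow> apply_bcontfun (g z) (h z)) (at z within A)"
    by (rule continuous_on_tendsto_compose[of UNIV, OF _ h]) auto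
  with g have "((\<lambda>w. dist (g w) (g z) + dist (apply_bcontfun (g z) (h w)) (apply_bcontfun (g z) (h z))) \<longlongrightarrow> 0 + 0)
      (at z within A)"
    by (intro tendsto_add) (simp_all flip: tendsto_dist_iff)
  then have lim: "((\<lambda>w. dist (g w) (g z) + dist (apply_bcontfun (g z) (h w)) (apply_bcontfun (g z) (h z))) \<longlongrightarrow> 0)
      (at z within A)" by simp
  have "dist (apply_bcontfun (g w) (h w)) (apply_bcontfun (g z) (h z))
      \<le> dist (g w) (g z) + dist (apply_bcontfun (g z) (h w)) (apply_bcontfun (g z) (h z))" for w
    using dist_triangle[of "apply_bcontfun (g w) (h w)" "apply_bcontfun (g z) (h z)" "apply_bcontfun (g z) (h w)"]
      dist_bounded[of "g w" "h w" "g z"] by simp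
  then have "((\<lambda>w. dist (apply_bcontfun (g w) (h w)) (apply_bcontfun (g z) (h z))) \<longlongrightarrow> 0) (at z within A)"
    by (intro tendsto_sandwich[OF _ _ tendsto_const lim]) (auto intro: always_eventually)
  then show "((\<lambda>w. apply_bcontfun (g w) (h w)) \<longlongrightarrow> apply_bcontfun (g z) (h z)) (at z within A)"
    by (rule tendsto_dist_iff[THEN iffD2])
qed

lemma random_maps_pairs:
  fixes f :: "'i \<Rightarrow> ('m::metric_space \<Rightarrow>\<^sub>C 'm)"
  assumes "compact (UNIV :: 'm set)" and rds: "random_dynamical_system f \<mu>" and "0 < \<alpha>"
  shows "random_maps \<mu> (\<lambda>i p. (f i (fst p), f i (snd p)))
    (\<lambda>p. dist (fst p) (snd p) powr \<alpha>) (diameter (UNIV :: 'm set) powr \<alpha>)"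
proof -
  interpret prob_space \<mu> using rds by (simp add: random_dynamical_system_def)
  interpret sequence_space \<mu> ..
  show ?thesis
  proof
    show "compact (UNIV :: ('m \<times> 'm) set)"
      using compact_Times[OF assms(1) assms(1)] by simp
    have f: "f \<in> borel_measurable \<mu>"
      using rds measurable_vimage_algebra1[of f "space \<mu>" borel]
      by (simp add: random_dynamical_system_def cong: measurable_cong_sets)
    show "(\<lambda>i. (f i (fst a), f i (snd a))) \<in> borel_measurable \<mu>" for a
      by (rule borel_measurable_continuous_on[OF _ f, of "\<lambda>g. (apply_bcontfun g (fst a), apply_bcontfun g (snd a))"])
        (intro continuous_intros continuous_on_bcontfun_apply)
    show "continuous_on UNIV (\<lambda>p. (f i (fst p), f i (snd p)))" for i
      by (intro continuous_intros continuous_on_bcontfun_apply)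
    show "(\<lambda>p. dist (fst p) (snd p :: 'm) powr \<alpha>) \<in> borel_measurable borel"
    proof -
      have [measurable]: "(\<lambda>p. dist (fst p) (snd p :: 'm)) \<in> borel_measurable borel"
        by (intro borel_measurable_continuous_onI continuous_intros)
      show ?thesis by measurable
    qed
    show "0 \<le> dist (fst p) (snd p) powr \<alpha>" for p :: "'m \<times> 'm" by simp
    show "dist (fst p) (snd p) powr \<alpha> \<le> diameter (UNIV :: 'm set) powr \<alpha>" for p :: "'m \<times> 'm"
      using assms(1) \<open>0 < \<alpha>\<close>
      by (intro powr_mono2 diameter_bounded_bound compact_imp_bounded) auto
    fix i a and W :: "('m \<times> 'm) set"
    assume i: "i \<in> space \<mu>" and W: "open W" "(f i (fst a), f i (snd a)) \<in> W"
    \<comment> \<open>Treating the map as a variable alongside the pair, joint continuity yields a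
      product neighbourhood \<open>A \<times> W'\<close> of \<open>(f i, a)\<close> sent into
      \<open>W\<close>. The indices with map in \<open>A\<close> form an open set around
      \<open>i\<close>, of positive measure by full support.\<close>
    let ?e = "\<lambda>p :: ('m \<Rightarrow>\<^sub>C 'm) \<times> 'm \<times> 'm. (apply_bcontfun (fst p) (fst (snd p)), apply_bcontfun (fst p) (snd (snd p)))"
    have "continuous_on UNIV ?e"
      by (intro continuous_intros continuous_on_bcontfun_apply)
    then have "open (?e -` W)" by (rule open_vimage[OF W(1)])
    moreover have "(f i, a) \<in> ?e -` W" using W(2) by simp
    ultimately obtain A W' where A: "open A" "open W'" "(f i, a) \<in> A \<times> W'" and sub: "A \<times> W' \<subseteq> ?e -` W"
      by (rule open_prod_elim)
    let ?V = "f -` A \<inter> space \<mu>"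
    have "?V \<in> sets \<mu>" using f A(1) by (intro measurable_sets[OF f]) simp
    moreover have "0 < measure \<mu> ?V"
    proof -
      have "i \<in> topological_support (index_topology f (space \<mu>)) \<mu>"
        using rds i by (simp add: random_dynamical_system_def)
      moreover have "openin (index_topology f (space \<mu>)) ?V"
        unfolding index_topology_def openin_pullback_topology using A(1) by auto
      ultimately have "0 < emeasure \<mu> ?V"
        using i A(3) by (auto simp: topological_support_def)
      then show ?thesis by (simp add: measure_def enn2real_positive_iff less_top[symmetric])
    qed
    moreover have "\<forall>j\<in>?V. \<forall>b\<in>W'. (f j (fst b), f j (snd b)) \<in> W"
      using sub by fastforce
    ultimately show "\<exists>V W'. V \<in> sets \<mu> \<and> 0 < measure \<mu> V \<and> open W' \<and> a \<in> W' \<and>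
        (\<forall>j\<in>V. \<forall>b\<in>W'. (f j (fst b), f j (snd b)) \<in> W)"
      using A by blast
  qed
qed

lemma pair_sums_bounded:
  fixes f :: "'i \<Rightarrow> ('m::metric_space \<Rightarrow>\<^sub>C 'm)"
  assumes compact: "compact (UNIV :: 'm set)"
    and rds: "random_dynamical_system f \<mu>"
    and prox: "proximal f (space \<mu>)"
    and q: "0 < q" "q < 1"
    and contr: "local_contraction f \<mu> q"
    and "0 < \<alpha>"
  obtains C where "0 < C" and "\<And>n x y. (\<Sum>k\<le>n. \<integral>\<omega>. dist (random_orbit f k x \<omega>) (random_orbit f k y \<omega>) powr \<alpha>
          \<partial>sequence_measure \<mu>) \<le> C"
proof -
  interpret random_maps \<mu> "\<lambda>i p. (f i (fst p), f i (snd p))"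
    "\<lambda>p. dist (fst p) (snd p) powr \<alpha>" "diameter (UNIV :: 'm set) powr \<alpha>"
    by (rule random_maps_pairs[OF compact rds \<open>0 < \<alpha>\<close>])
  have orbit: "orbit \<omega> n p = (random_iterate f \<omega> n (fst p), random_iterate f \<omega> n (snd p))" for \<omega> n p
    by (induction n) auto
  have diag: "good (x, x)" for x
  proof (rule good_if_locally_dominated)
    \<comment> \<open>Contraction is assumed only from time 1 on, so the term at time 0 is bounded
      by the diameter of the space.\<close>
    let ?c = "\<lambda>m. if m = 0 then diameter (UNIV :: 'm set) powr \<alpha> else (q powr \<alpha>) ^ m"
    show "0 \<le> ?c m" for m by simp
    have "summable (\<lambda>m. (q powr \<alpha>) ^ m)"
      using q \<open>0 < \<alpha>\<close> powr_less_mono2[of \<alpha> q 1] by (intro summable_geometric) simp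
    then show "summable ?c"
      by (rule summable_cong[THEN iffD2, rotated]) (auto simp: eventually_sequentially intro: exI[of _ 1])
    have "AE \<omega> in S. \<exists>B. x \<in> interior B \<and> (\<forall>n\<ge>1. diameter (random_iterate f \<omega> n ` B) \<le> q ^ n)"
      using contr by (simp add: local_contraction_def)
    then show "AE \<omega> in S. \<exists>W. open W \<and> (x, x) \<in> W \<and>
        (\<forall>b\<in>W. \<forall>m. dist (fst (orbit \<omega> m b)) (snd (orbit \<omega> m b)) powr \<alpha> \<le> ?c m)"
    proof eventually_elim
      case (elim \<omega>)
      then obtain B where B: "x \<in> interior B" "\<And>n. 1 \<le> n \<Longrightarrow> diameter (random_iterate f \<omega> n ` B) \<le> q ^ n"
        by blast
      have "dist (fst (orbit \<omega> m b)) (snd (orbit \<omega> m b)) powr \<alpha> \<le> ?c m"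
        if b: "b \<in> interior B \<times> interior B" for b m
      proof (cases "m = 0")
        case False
        \<comment> \<open>Without boundedness \<open>diameter\<close> would not control
          distances.\<close>
        have "bounded (random_iterate f \<omega> m ` B)"
          using compact_imp_bounded[OF compact] bounded_subset by blast
        then have "dist (fst (orbit \<omega> m b)) (snd (orbit \<omega> m b)) \<le> diameter (random_iterate f \<omega> m ` B)"
          unfolding orbit using b interior_subset[of B] by (intro diameter_bounded_bound) auto
        also have "\<dots> \<le> q ^ m" using B(2) False by simp
        finally have "dist (fst (orbit \<omega> m b)) (snd (orbit \<omega> m b)) powr \<alpha> \<le> (q ^ m) powr \<alpha>"
          using \<open>0 < \<alpha>\<close> by (intro powr_mono2) auto
        then show ?thesis using False q
          by (simp add: powr_realpow[symmetric] powr_powr mult.commute)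
      next
        case True
        then show ?thesis using \<phi>_le[of b] by simp
      qed
      then show ?case using B(1) by (intro exI[of _ "interior B \<times> interior B"]) (auto simp: open_Times)
    qed
  qed
  have good_pair: "good (x, y)" for x y
  proof -
    obtain \<omega> and r :: "nat \<Rightarrow> nat" where \<omega>: "range \<omega> \<subseteq> space \<mu>"
      and lim: "(\<lambda>k. dist (random_iterate f \<omega> (r k) x) (random_iterate f \<omega> (r k) y)) \<longlonglongrightarrow> 0"
      using prox unfolding proximal_def by metis
    \<comment> \<open>Proximality controls only the distance; compactness makes the pairs themselves
      converge along a subsequence, to a limit on the diagonal. Since the good set is open, some
      iterate of the pair is good, and goodness is pulled back along the orbit.\<close>
    obtain l s where s: "strict_mono (s :: nat \<Rightarrow> nat)"
      and l: "((\<lambda>k. orbit \<omega> (r k) (x, y)) \<circ> s) \<longlonglongrightarrow> l"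
      using compact_UNIV[unfolded compact_eq_seq_compact_metric]
      by (rule seq_compactE) auto
    have "(\<lambda>k. dist (random_iterate f \<omega> (r (s k)) x) (random_iterate f \<omega> (r (s k)) y)) \<longlonglongrightarrow> dist (fst l) (snd l)"
      using tendsto_dist[OF tendsto_fst[OF l] tendsto_snd[OF l]] by (simp add: orbit o_def)
    moreover have "(\<lambda>k. dist (random_iterate f \<omega> (r (s k)) x) (random_iterate f \<omega> (r (s k)) y)) \<longlonglongrightarrow> 0"
      using LIMSEQ_subseq_LIMSEQ[OF lim s] by (simp add: o_def)
    ultimately have "dist (fst l) (snd l) = 0" by (rule LIMSEQ_unique)
    then have "good l" using diag[of "fst l"] by (cases l) simp
    then have "\<forall>\<^sub>F k in sequentially. ((\<lambda>k. orbit \<omega> (r k) (x, y)) \<circ> s) k \<in> {a. good a}"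
      by (intro topological_tendstoD[OF l open_good]) simp
    then obtain k where k: "good (orbit \<omega> (r (s k)) (x, y))"
      by (auto simp: eventually_sequentially)
    show ?thesis by (rule good_orbit[OF _ k]) (use \<omega> in auto)
  qed
  have all_good: "good a" for a using good_pair[of "fst a" "snd a"] by simp
  obtain C where "0 < C" and C: "\<And>n a. total n a \<le> C"
    using total_bounded[OF all_good] by blast
  show thesis
  proof (rule that[OF \<open>0 < C\<close>])
    show "(\<Sum>k\<le>n. \<integral>\<omega>. dist (random_orbit f k x \<omega>) (random_orbit f k y \<omega>) powr \<alpha>
          \<partial>sequence_measure \<mu>) \<le> C" for n x y
      using C[of n "(x, y)"] by (simp add: total_def orbit)
  qed
qed

theorem theorem1p4:
  fixes f :: "'i \<Rightarrow> ('m::metric_space \<Rightarrow>\<^sub>C 'm)"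
    and \<mu> :: "'i measure"
    and q :: real
  assumes "compact (UNIV :: 'm set)"
    and "random_dynamical_system f \<mu>"
    and "proximal f (space \<mu>)"
    and "0 < q" and "q < 1"
    and "local_contraction f \<mu> q"
  shows "\<forall>\<alpha>. 0 < \<alpha> \<and> \<alpha> \<le> 1 \<longrightarrow>
    (\<exists>C>0. \<forall>n::nat.
      (SUP (x, y) \<in> UNIV. \<Sum>k\<le>n. \<integral>\<omega>. dist (random_orbit f k x \<omega>) (random_orbit f k y \<omega>) powr \<alpha>
          \<partial>sequence_measure \<mu>)
        \<le> C * (\<Sum>k\<le>n. q powr (real k * \<alpha>)))"
proof (intro allI impI)
  fix \<alpha> :: real
  assume \<alpha>: "0 < \<alpha> \<and> \<alpha> \<le> 1"
  obtain C where "0 < C" and C: "\<And>n x y. (\<Sum>k\<le>n. \<integral>\<omega>. dist (random_orbit f k x \<omega>) (random_orbit f k y \<omega>) powr \<alpha>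
          \<partial>sequence_measure \<mu>) \<le> C"
    using pair_sums_bounded[OF assms] \<alpha> by blast
  show "\<exists>C>0. \<forall>n::nat.
      (SUP (x, y) \<in> UNIV. \<Sum>k\<le>n. \<integral>\<omega>. dist (random_orbit f k x \<omega>) (random_orbit f k y \<omega>) powr \<alpha>
          \<partial>sequence_measure \<mu>)
        \<le> C * (\<Sum>k\<le>n. q powr (real k * \<alpha>))"
  proof (intro exI[of _ C] conjI allI \<open>0 < C\<close>)
    fix n :: nat
    \<comment> \<open>The term \<open>k = 0\<close> equals 1 because \<open>q\<close> is nonzero
      (\<open>0 powr 0\<close> is 0), so the sum is at least 1.\<close>
    have "(\<Sum>k\<in>{0}. q powr (real k * \<alpha>)) \<le> (\<Sum>k\<le>n. q powr (real k * \<alpha>))"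
      by (rule sum_mono2) auto
    then have "1 \<le> (\<Sum>k\<le>n. q powr (real k * \<alpha>))" using \<open>0 < q\<close> by simp
    then have "C \<le> C * (\<Sum>k\<le>n. q powr (real k * \<alpha>))" using \<open>0 < C\<close> by simp
    moreover have "(SUP (x, y) \<in> UNIV. \<Sum>k\<le>n. \<integral>\<omega>. dist (random_orbit f k x \<omega>) (random_orbit f k y \<omega>) powr \<alpha>
          \<partial>sequence_measure \<mu>) \<le> C"
      by (rule cSUP_least) (use C in \<open>auto simp: split_beta\<close>)
    ultimately show "(SUP (x, y) \<in> UNIV. \<Sum>k\<le>n. \<integral>\<omega>. dist (random_orbit f k x \<omega>) (random_orbit f k y \<omega>) powr \<alpha>
          \<partial>sequence_measure \<mu>) \<le> C * (\<Sum>k\<le>n. q powr (real k * \<alpha>))" by linarith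
  qed
qed

end
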